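(* Let $G$ be a topological group (not necessarily locally compact), let $H\subset G$ be a closed amenable subgroup, and let $\tau$ be a unitary representation of $H$ on a Hilbert space $E_\tau$, with associated homogeneous Hilbert space bundle $\mathbb{E}_\tau\to G/H$. Let $RUC_b(G/H;\mathbb{E}_\tau)$ be the space of bounded right uniformly continuous sections of $\mathbb{E}_\tau\to G/H$, let $\mathcal{M}=\mathcal{M}(G/H)$ be the set of all means on $G/H$, and for $\mu\in\mathcal{M}$ let $\nu_\mu(f)=\mu(\|f\|)$ be the corresponding seminorm on $RUC_b(G/H;\mathbb{E}_\tau)$. If $0\neq f\in RUC_b(G/H;\mathbb{E}_\tau)$, then there exists $\mu\in\mathcal{M}$ such that $\nu_\mu(f)\neq 0$. In other words, the space $\Gamma_{\mathcal{M}}(G/H;\mathbb{E}_\tau)$ is the locally convex topological vector space completion of $RUC_b(G/H;\mathbb{E}_\tau)$ itself (for the topology defined by the seminorms $\nu_\mu$, $\mu\in\mathcal{M}$), with no passage to a proper quotient.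
   Context: A function $f$ on $G$ with values in a normed space is called right uniformly continuous if for every $\varepsilon>0$ there is a neighborhood $U$ of the identity in $G$ such that $\|f(ux)-f(x)\|<\varepsilon$ for all $u\in U$ and $x\in G$. The space $RUC_b(G/H;\mathbb{E}_\tau)$ of bounded right uniformly continuous sections of $\mathbb{E}_\tau\to G/H$ consists of the bounded right uniformly continuous functions $f:G\to E_\tau$ such that $f(xh)=\tau(h)^{-1}f(x)$ for all $x\in G$ and $h\in H$. The group $G$ acts on it by $(\pi_\tau(x)f)(x')=f(x^{-1}x')$. Since $\tau$ is unitary, the pointwise norm $\|f\|:xH\mapsto\|f(xH)\|:=\|f(x)\|$ is a well-defined function on $G/H$. Let $RUC_b(G/H)$ denote the space of bounded scalar-valued functions on $G/H$ whose lifts to $G$ are right uniformly continuous; then $\|f\|\in RUC_b(G/H)$ for $f\in RUC_b(G/H;\mathbb{E}_\tau)$. A mean on $G/H$ is a linear functional $\mu$ on $RUC_b(G/H)$ such that $\mu(1)=1$ and $\mu(\varphi)\geq 0$ whenever $\varphi\geq 0$. No invariance is required; $\mathcal{M}(G/H)$ is the set of all means on $G/H$. A topological group $H$ is amenable if every continuous affine action of $H$ on a nonempty compact convex subset of a locally convex (Hausdorff) topological vector space has a fixed point. The space $\Gamma_{\mathcal{M}}(G/H;\mathbb{E}_\tau)$ is defined as follows. Let $J_{\mathcal{M}}=\{f\in RUC_b(G/H;\mathbb{E}_\tau)\mid \nu_\mu(f)=0\text{ for all }\mu\in\mathcal{M}\}$. The seminorms $\nu_\mu$, $\mu\in\mathcal{M}$,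 descend to $RUC_b(G/H;\mathbb{E}_\tau)/J_{\mathcal{M}}$ and define on it a Hausdorff locally convex topology; $\Gamma_{\mathcal{M}}(G/H;\mathbb{E}_\tau)$ is the completion of $RUC_b(G/H;\mathbb{E}_\tau)/J_{\mathcal{M}}$ for that topology. (Thus the last assertion of the claim says that $J_{\mathcal{M}}=0$.) *)

theory Defs
  imports
    "HOL-Analysis.Analysis"
    "HOL-Algebra.Module"
    "HOL-Algebra.AbelCoset"
    "HOL-Algebra.Left_Coset"
    "HOL-Algebra.Group_Action"
begin

section \<open>Complex Hilbert spaces and unitary operators\<close>

text \<open>The inner product is linear in the first and conjugate-linear in the second argument.\<close>

class complex_hilbert_space = banach +
  fixes scaleC :: "complex \<Rightarrow> 'a \<Rightarrow> 'a" (infixr \<open>*\<^sub>C\<close> 75)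
    and cinner :: "'a \<Rightarrow> 'a \<Rightarrow> complex"
  assumes scaleC_add_right: "c *\<^sub>C (x + y) = c *\<^sub>C x + c *\<^sub>C y"
    and scaleC_add_left: "(c + d) *\<^sub>C x = c *\<^sub>C x + d *\<^sub>C x"
    and scaleC_scaleC: "c *\<^sub>C (d *\<^sub>C x) = (c * d) *\<^sub>C x"
    and scaleC_one: "1 *\<^sub>C x = x"
    and scaleR_scaleC: "r *\<^sub>R x = complex_of_real r *\<^sub>C x"
    and cinner_commute: "cinner x y = cnj (cinner y x)"
    and cinner_add_left: "cinner (x + y) z = cinner x z + cinner y z"
    and cinner_scaleC_left: "cinner (c *\<^sub>C x) y = c * cinner x y"
    and cinner_self: "cinner x x = complex_of_real ((norm x)\<^sup>2)"

instantiation complex :: complex_hilbert_space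
begin

definition scaleC_complex :: "complex \<Rightarrow> complex \<Rightarrow> complex"
  where "scaleC_complex c x = c * x"

definition cinner_complex :: "complex \<Rightarrow> complex \<Rightarrow> complex"
  where "cinner_complex x y = x * cnj y"

instance
  by standard
    (simp_all add: scaleC_complex_def cinner_complex_def algebra_simps scaleR_conv_of_real
      complex_mult_cnj cmod_power2)

end

definition unitary_operator :: "('e::complex_hilbert_space \<Rightarrow> 'e) \<Rightarrow> bool"
  where "unitary_operator A \<longleftrightarrow>
    (\<forall>v w. A (v + w) = A v + A w) \<and>
    (\<forall>c v. A (c *\<^sub>C v) = c *\<^sub>C A v) \<and>
    (\<forall>v w. cinner (A v) (A w) = cinner v w) \<and>
    surj A"


section \<open>Topological vector spaces on a carrier set\<close>

text \<open>
  Vector spaces are modules over the field of all elements of a type \<open>'k\<close>, which is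
  \<^typ>\<open>real\<close> or \<^typ>\<open>complex\<close> below. The fields \<^const>\<open>mult\<close> and \<^const>\<open>one\<close> that module
  records inherit from ring records play no role for modules.
\<close>

definition scalars :: "'k::field ring"
  where "scalars = \<lparr>carrier = UNIV, mult = (*), one = 1, zero = 0, add = (+)\<rparr>"

definition convex_in :: "('k::real_normed_field, 'v) module \<Rightarrow> 'v set \<Rightarrow> bool"
  where "convex_in V S \<longleftrightarrow> (\<forall>x\<in>S. \<forall>y\<in>S. \<forall>t\<in>{0..1}.
    (of_real (1 - t) \<odot>\<^bsub>V\<^esub> x) \<oplus>\<^bsub>V\<^esub> (of_real t \<odot>\<^bsub>V\<^esub> y) \<in> S)"

locale hausdorff_lctvs = module scalars V
  for V :: "('k::real_normed_field, 'v) module" (structure) and T :: "'v topology" +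
  assumes topspace_eq: "topspace T = carrier V"
    and continuous_add: "continuous_map (prod_topology T T) T (\<lambda>(x, y). x \<oplus>\<^bsub>V\<^esub> y)"
    and continuous_smult:
      "continuous_map (prod_topology euclidean T) T (\<lambda>(c, x). c \<odot>\<^bsub>V\<^esub> x)"
    and locally_convex: "neighbourhood_base_of (convex_in V) T"
    and hausdorff: "Hausdorff_space T"

definition tvs_complete :: "('k, 'v) module \<Rightarrow> 'v topology \<Rightarrow> bool"
  where "tvs_complete V T \<longleftrightarrow>
    (\<forall>F. F \<noteq> bot \<and> F \<le> principal (carrier V) \<and>
        (\<forall>U. openin T U \<and> \<zero>\<^bsub>V\<^esub> \<in> U \<longrightarrow>
          (\<forall>\<^sub>F (x, y) in F \<times>\<^sub>F F. x \<ominus>\<^bsub>V\<^esub> y \<in> U))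
      \<longrightarrow> (\<exists>l\<in>carrier V. F \<le> nhdsin T l))"

definition linear_between :: "('k, 'v) module \<Rightarrow> ('k, 'w) module \<Rightarrow> ('v \<Rightarrow> 'w) \<Rightarrow> bool"
  where "linear_between V W f \<longleftrightarrow>
    f \<in> carrier V \<rightarrow> carrier W \<and>
    (\<forall>x\<in>carrier V. \<forall>y\<in>carrier V. f (x \<oplus>\<^bsub>V\<^esub> y) = f x \<oplus>\<^bsub>W\<^esub> f y) \<and>
    (\<forall>c. \<forall>x\<in>carrier V. f (c \<odot>\<^bsub>V\<^esub> x) = c \<odot>\<^bsub>W\<^esub> f x)"

text \<open>
  A completion of \<open>(V, T)\<close> is a complete Hausdorff locally convex space together with a
  linear topological embedding of \<open>V\<close> onto a dense subspace; a linear embedding is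
  automatically an isomorphism of uniform structures onto its image.
\<close>

definition is_completion ::
    "('k::real_normed_field, 'v) module \<Rightarrow> 'v topology \<Rightarrow>
     ('k, 'w) module \<Rightarrow> 'w topology \<Rightarrow> ('v \<Rightarrow> 'w) \<Rightarrow> bool"
  where "is_completion V T W S \<iota> \<longleftrightarrow>
    hausdorff_lctvs W S \<and> tvs_complete W S \<and>
    linear_between V W \<iota> \<and> embedding_map T S \<iota> \<and>
    S closure_of (\<iota> ` carrier V) = carrier W"

definition seminorm_topology :: "('k, 'v) module \<Rightarrow> ('v \<Rightarrow> real) set \<Rightarrow> 'v topology"
  where "seminorm_topology V P = topology_generated_by
    {{y \<in> carrier V. p (y \<ominus>\<^bsub>V\<^esub> x) < r} | p x r. p \<in> P \<and> x \<in> carrier V \<and> 0 < r}"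

definition quotient_module :: "('k, 'v) module \<Rightarrow> 'v set \<Rightarrow> ('k, 'v set) module"
  where "quotient_module V N =
    \<lparr>carrier = a_rcosets\<^bsub>V\<^esub> N, mult = (\<lambda>_ _. N), one = N, zero = N, add = set_add V,
     smult = (\<lambda>c X. \<Union>x\<in>X. N +>\<^bsub>V\<^esub> (c \<odot>\<^bsub>V\<^esub> x))\<rparr>"

text \<open>
  Meaningful if \<open>p\<close> is constant on each coset, so that \<^term>\<open>p ` X\<close> is a singleton.
\<close>

definition descended_seminorm :: "('v \<Rightarrow> real) \<Rightarrow> 'v set \<Rightarrow> real"
  where "descended_seminorm p X = the_elem (p ` X)"


section \<open>Topological groups, amenability and unitary representations\<close>

locale topological_group = group G
  for G :: "('g, 'm) monoid_scheme" (structure) and T :: "'g topology" +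
  assumes topspace_eq: "topspace T = carrier G"
    and continuous_mult: "continuous_map (prod_topology T T) T (\<lambda>(x, y). x \<otimes>\<^bsub>G\<^esub> y)"
    and continuous_inv: "continuous_map T T (\<lambda>x. inv\<^bsub>G\<^esub> x)"

definition continuous_affine_action ::
    "('g, 'm) monoid_scheme \<Rightarrow> 'g topology \<Rightarrow>
     (real, 'v) module \<Rightarrow> 'v topology \<Rightarrow> 'v set \<Rightarrow> ('g \<Rightarrow> 'v \<Rightarrow> 'v) \<Rightarrow> bool"
  where "continuous_affine_action G T V S K \<phi> \<longleftrightarrow>
    group_action G K \<phi> \<and>
    continuous_map (prod_topology T (subtopology S K)) (subtopology S K) (\<lambda>(g, x). \<phi> g x) \<and>
    (\<forall>g\<in>carrier G. \<forall>x\<in>K. \<forall>y\<in>K. \<forall>t\<in>{0..1}.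
      \<phi> g (((1 - t) \<odot>\<^bsub>V\<^esub> x) \<oplus>\<^bsub>V\<^esub> (t \<odot>\<^bsub>V\<^esub> y)) =
        ((1 - t) \<odot>\<^bsub>V\<^esub> \<phi> g x) \<oplus>\<^bsub>V\<^esub> (t \<odot>\<^bsub>V\<^esub> \<phi> g y))"

text \<open>
  HOL cannot quantify over all types inside a formula, so the locally convex space \<open>V\<close>
  ranges over all spaces whose carrier is an arbitrary subset of the type
  \<^typ>\<open>('g \<Rightarrow> real) \<Rightarrow> real\<close>. This loses no generality. Given an action on \<open>K\<close>, the closed
  convex hull \<open>K'\<close> of an orbit is invariant and has a dense subset of cardinality at most
  \<open>d = max |G| \<aleph>\<^sub>0\<close>; since the space is Hausdorff, \<open>K'\<close> and its linear span have cardinality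
  at most \<open>2^(2^d)\<close>, hence at most that of the type above. So the span is isomorphic to a
  space in the range of the quantifier, and a fixed point there is one in \<open>K\<close>.
  Real scalars suffice because affine maps only involve real scalars, and complex
  locally convex spaces are in particular real ones.
\<close>

definition amenable :: "('g, 'm) monoid_scheme \<Rightarrow> 'g topology \<Rightarrow> bool"
  where "amenable G T \<longleftrightarrow>
    (\<forall>(V :: (real, ('g \<Rightarrow> real) \<Rightarrow> real) module) S K \<phi>.
      hausdorff_lctvs V S \<and>
      K \<subseteq> carrier V \<and> K \<noteq> {} \<and> compactin S K \<and> convex_in V K \<and>
      continuous_affine_action G T V S K \<phi>
      \<longrightarrow> (\<exists>x\<in>K. \<forall>g\<in>carrier G. \<phi> g x = x))"

text \<open>Continuity of a representation means strong continuity.\<close>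

definition unitary_representation ::
    "('g, 'm) monoid_scheme \<Rightarrow> 'g topology \<Rightarrow> ('g \<Rightarrow> 'e::complex_hilbert_space \<Rightarrow> 'e) \<Rightarrow> bool"
  where "unitary_representation G T \<tau> \<longleftrightarrow>
    (\<forall>g\<in>carrier G. unitary_operator (\<tau> g)) \<and>
    (\<forall>g\<in>carrier G. \<forall>h\<in>carrier G. \<tau> (g \<otimes>\<^bsub>G\<^esub> h) = \<tau> g \<circ> \<tau> h) \<and>
    (\<forall>v. continuous_map T euclidean (\<lambda>g. \<tau> g v))"


section \<open>Sections, means and seminorms\<close>

definition right_uniformly_continuous ::
    "('g, 'm) monoid_scheme \<Rightarrow> 'g topology \<Rightarrow> ('g \<Rightarrow> 'e::real_normed_vector) \<Rightarrow> bool"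
  where "right_uniformly_continuous G T f \<longleftrightarrow>
    (\<forall>\<epsilon>>0. \<exists>U. openin T U \<and> \<one>\<^bsub>G\<^esub> \<in> U \<and>
      (\<forall>u\<in>U. \<forall>x\<in>carrier G. norm (f (u \<otimes>\<^bsub>G\<^esub> x) - f x) < \<epsilon>))"

text \<open>
  A function on the carrier of \<open>G\<close>, or on the set \<^term>\<open>lcosets\<^bsub>G\<^esub> H\<close> of left cosets
  that is the underlying set of \<open>G/H\<close>, is represented by its extension by \<open>0\<close> to the whole
  type. Equality of functions is then equality in HOL.
\<close>

definition RUC_sections ::
    "('g, 'm) monoid_scheme \<Rightarrow> 'g topology \<Rightarrow> 'g set \<Rightarrow>
     ('g \<Rightarrow> 'e::complex_hilbert_space \<Rightarrow> 'e) \<Rightarrow> ('g \<Rightarrow> 'e) set"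
  where "RUC_sections G T H \<tau> = {f.
    (\<forall>x. x \<notin> carrier G \<longrightarrow> f x = 0) \<and>
    bounded (f ` carrier G) \<and>
    right_uniformly_continuous G T f \<and>
    (\<forall>x\<in>carrier G. \<forall>h\<in>H. f (x \<otimes>\<^bsub>G\<^esub> h) = inv_into UNIV (\<tau> h) (f x))}"

definition RUC_section_space ::
    "('g, 'm) monoid_scheme \<Rightarrow> 'g topology \<Rightarrow> 'g set \<Rightarrow>
     ('g \<Rightarrow> 'e::complex_hilbert_space \<Rightarrow> 'e) \<Rightarrow> (complex, 'g \<Rightarrow> 'e) module"
  where "RUC_section_space G T H \<tau> =
    \<lparr>carrier = RUC_sections G T H \<tau>, mult = (\<lambda>_ _. \<lambda>x. 0), one = (\<lambda>x. 0),
     zero = (\<lambda>x. 0), add = (\<lambda>f g x. f x + g x), smult = (\<lambda>c f x. c *\<^sub>C f x)\<rparr>"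

definition RUC_quotient ::
    "('g, 'm) monoid_scheme \<Rightarrow> 'g topology \<Rightarrow> 'g set \<Rightarrow> ('g set \<Rightarrow> complex) set"
  where "RUC_quotient G T H = {\<phi>.
    (\<forall>X. X \<notin> lcosets\<^bsub>G\<^esub> H \<longrightarrow> \<phi> X = 0) \<and>
    bounded (\<phi> ` (lcosets\<^bsub>G\<^esub> H)) \<and>
    right_uniformly_continuous G T (\<lambda>x. \<phi> (x <#\<^bsub>G\<^esub> H))}"

definition means ::
    "('g, 'm) monoid_scheme \<Rightarrow> 'g topology \<Rightarrow> 'g set \<Rightarrow> (('g set \<Rightarrow> complex) \<Rightarrow> complex) set"
  where "means G T H = {\<mu> \<in> extensional (RUC_quotient G T H).
    (\<forall>\<phi>\<in>RUC_quotient G T H. \<forall>\<psi>\<in>RUC_quotient G T H. \<mu> (\<lambda>X. \<phi> X + \<psi> X) = \<mu> \<phi> + \<mu> \<psi>) \<and>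
    (\<forall>c. \<forall>\<phi>\<in>RUC_quotient G T H. \<mu> (\<lambda>X. c * \<phi> X) = c * \<mu> \<phi>) \<and>
    \<mu> (indicator (lcosets\<^bsub>G\<^esub> H)) = 1 \<and>
    (\<forall>\<phi>\<in>RUC_quotient G T H. (\<forall>X\<in>lcosets\<^bsub>G\<^esub> H. \<phi> X \<in> \<real>\<^sub>\<ge>\<^sub>0) \<longrightarrow> \<mu> \<phi> \<in> \<real>\<^sub>\<ge>\<^sub>0)}"

text \<open>The set of norms of the values of \<open>f\<close> on a coset is a singleton as \<open>\<tau>\<close> is unitary.\<close>

definition pointwise_norm ::
    "('g, 'm) monoid_scheme \<Rightarrow> 'g set \<Rightarrow> ('g \<Rightarrow> 'e::real_normed_vector) \<Rightarrow> 'g set \<Rightarrow> complex"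
  where "pointwise_norm G H f X =
    (if X \<in> lcosets\<^bsub>G\<^esub> H then complex_of_real (the_elem ((\<lambda>x. norm (f x)) ` X)) else 0)"

text \<open>The value of a mean on a pointwise norm is a nonnegative real number.\<close>

definition mean_seminorm ::
    "('g, 'm) monoid_scheme \<Rightarrow> 'g set \<Rightarrow> (('g set \<Rightarrow> complex) \<Rightarrow> complex) \<Rightarrow>
     ('g \<Rightarrow> 'e::real_normed_vector) \<Rightarrow> real"
  where "mean_seminorm G H \<mu> f = Re (\<mu> (pointwise_norm G H f))"

definition J_means ::
    "('g, 'm) monoid_scheme \<Rightarrow> 'g topology \<Rightarrow> 'g set \<Rightarrow>
     ('g \<Rightarrow> 'e::complex_hilbert_space \<Rightarrow> 'e) \<Rightarrow> ('g \<Rightarrow> 'e) set"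
  where "J_means G T H \<tau> =
    {f \<in> RUC_sections G T H \<tau>. \<forall>\<mu>\<in>means G T H. mean_seminorm G H \<mu> f = 0}"

definition RUC_section_topology ::
    "('g, 'm) monoid_scheme \<Rightarrow> 'g topology \<Rightarrow> 'g set \<Rightarrow>
     ('g \<Rightarrow> 'e::complex_hilbert_space \<Rightarrow> 'e) \<Rightarrow> ('g \<Rightarrow> 'e) topology"
  where "RUC_section_topology G T H \<tau> =
    seminorm_topology (RUC_section_space G T H \<tau>) (mean_seminorm G H ` means G T H)"

definition reduced_section_space ::
    "('g, 'm) monoid_scheme \<Rightarrow> 'g topology \<Rightarrow> 'g set \<Rightarrow>
     ('g \<Rightarrow> 'e::complex_hilbert_space \<Rightarrow> 'e) \<Rightarrow> (complex, ('g \<Rightarrow> 'e) set) module"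
  where "reduced_section_space G T H \<tau> =
    quotient_module (RUC_section_space G T H \<tau>) (J_means G T H \<tau>)"

definition reduced_section_topology ::
    "('g, 'm) monoid_scheme \<Rightarrow> 'g topology \<Rightarrow> 'g set \<Rightarrow>
     ('g \<Rightarrow> 'e::complex_hilbert_space \<Rightarrow> 'e) \<Rightarrow> ('g \<Rightarrow> 'e) set topology"
  where "reduced_section_topology G T H \<tau> =
    seminorm_topology (reduced_section_space G T H \<tau>)
      ((\<lambda>\<mu>. descended_seminorm (mean_seminorm G H \<mu>)) ` means G T H)"

text \<open>
  \<open>\<Gamma>\<^sub>\<M>(G/H; E\<^sub>\<tau>)\<close> is determined up to isomorphism, as a complete space \<open>(\<Gamma>, S)\<close> with a
  canonical map \<open>\<iota>\<close> from the quotient of the space of sections by \<^const>\<open>J_means\<close>.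
\<close>

definition is_Gamma_means ::
    "('g, 'm) monoid_scheme \<Rightarrow> 'g topology \<Rightarrow> 'g set \<Rightarrow>
     ('g \<Rightarrow> 'e::complex_hilbert_space \<Rightarrow> 'e) \<Rightarrow>
     (complex, 'w) module \<Rightarrow> 'w topology \<Rightarrow> (('g \<Rightarrow> 'e) set \<Rightarrow> 'w) \<Rightarrow> bool"
  where "is_Gamma_means G T H \<tau> \<Gamma> S \<iota> \<longleftrightarrow>
    is_completion (reduced_section_space G T H \<tau>) (reduced_section_topology G T H \<tau>) \<Gamma> S \<iota>"

definition reduction_map ::
    "('g, 'm) monoid_scheme \<Rightarrow> 'g topology \<Rightarrow> 'g set \<Rightarrow>
     ('g \<Rightarrow> 'e::complex_hilbert_space \<Rightarrow> 'e) \<Rightarrow> ('g \<Rightarrow> 'e) \<Rightarrow> ('g \<Rightarrow> 'e) set"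
  where "reduction_map G T H \<tau> f = J_means G T H \<tau> +>\<^bsub>RUC_section_space G T H \<tau>\<^esub> f"

end

theory Submission
  imports Defs
begin

text \<open>
  The evaluation at a coset \<open>xH\<close> is a mean, and its seminorm sends \<open>f\<close> to \<open>\<parallel>f x\<parallel>\<close>. Hence the
  seminorms of the means separate the sections, and the quotient by \<^const>\<open>J_means\<close> is a
  quotient by the trivial subspace, whose cosets are singletons.
\<close>

section \<open>Unitary operators\<close>

text \<open>The class inherits from \<open>banach\<close> the rule for real scalars only; the
  complex one is extracted from \<open>cinner_self\<close> and sesquilinearity.\<close>

lemma norm_scaleC: "norm (c *\<^sub>C x) = cmod c * norm x"
  for x :: "'e::complex_hilbert_space"
proof -
  have "cinner (c *\<^sub>C x) (c *\<^sub>C x) = c * cnj c * cinner x x"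
    by (metis (no_types, lifting) cinner_commute cinner_scaleC_left complex_cnj_mult
        mult.assoc mult.left_commute)
  then have "complex_of_real ((norm (c *\<^sub>C x))\<^sup>2) = complex_of_real ((cmod c * norm x)\<^sup>2)"
    by (simp add: cinner_self complex_norm_square power_mult_distrib flip: of_real_power)
  then have "(norm (c *\<^sub>C x))\<^sup>2 = (cmod c * norm x)\<^sup>2"
    by (simp only: of_real_eq_iff)
  then show ?thesis
    by (simp add: power2_eq_iff_nonneg)
qed

lemma scaleC_diff_right: "c *\<^sub>C (x - y) = c *\<^sub>C x - c *\<^sub>C y"
  for x :: "'e::complex_hilbert_space"
  by (metis add_diff_cancel_right' diff_add_cancel scaleC_add_right)

lemma scaleC_zero_right: "c *\<^sub>C (0 :: 'e::complex_hilbert_space) = 0"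
  using scaleC_diff_right[of c 0 "0 :: 'e"] by simp

lemma norm_unitary: "unitary_operator A \<Longrightarrow> norm (A v) = norm v"
  by (metis unitary_operator_def cinner_self norm_ge_zero of_real_eq_iff power2_eq_iff_nonneg)

lemma unitary_diff: "unitary_operator A \<Longrightarrow> A (v - w) = A v - A w"
  by (metis unitary_operator_def add_diff_cancel_right' diff_add_cancel)

text \<open>Isometry together with additivity excludes a kernel; surjectivity is part of
  \<open>unitary_operator\<close>.\<close>

lemma bij_unitary:
  assumes "unitary_operator A"
  shows "bij A"
proof (rule bijI)
  show "inj A"
  proof (rule injI)
    fix v w assume "A v = A w"
    then have "norm (v - w) = 0"
      using norm_unitary[OF assms, of "v - w"] unitary_diff[OF assms, of v w] by simp
    then show "v = w" by simp
  qed
  show "surj A" using assms by (simp add: unitary_operator_def)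
qed

text \<open>The equivariance of sections is phrased through \<open>inv_into UNIV (\<tau> h)\<close>,
  so linearity and isometry are wanted for inverses.\<close>

lemma unitary_inv:
  assumes "unitary_operator A"
  shows "unitary_operator (inv_into UNIV A)"
proof -
  have A: "A (inv_into UNIV A v) = v" "inv_into UNIV A (A v) = v" for v
    using bij_unitary[OF assms] by (simp_all add: bij_is_surj surj_f_inv_f bij_is_inj)
  \<comment> \<open>Each linearity law comes from applying the inverse to an image under
    \<open>A\<close>, here of the sum of two preimages.\<close>
  have "inv_into UNIV A (v + w) = inv_into UNIV A v + inv_into UNIV A w" for v w
    using assms A(2)[of "inv_into UNIV A v + inv_into UNIV A w"]
    by (simp add: unitary_operator_def A(1))
  moreover have "inv_into UNIV A (c *\<^sub>C v) = c *\<^sub>C inv_into UNIV A v" for c v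
    using assms A(2)[of "c *\<^sub>C inv_into UNIV A v"] by (simp add: unitary_operator_def A(1))
  moreover have "cinner (inv_into UNIV A v) (inv_into UNIV A w) = cinner v w" for v w
  proof -
    have "cinner (A (inv_into UNIV A v)) (A (inv_into UNIV A w)) =
        cinner (inv_into UNIV A v) (inv_into UNIV A w)"
      using assms unfolding unitary_operator_def by blast
    then show ?thesis by (simp add: A(1))
  qed
  moreover have "surj (inv_into UNIV A)"
    by (rule surjI[of _ A]) (rule A(2))
  ultimately show ?thesis
    by (simp add: unitary_operator_def)
qed

lemma unitary_zero: "unitary_operator A \<Longrightarrow> A 0 = 0"
  using unitary_diff[of A 0 0] by simp


section \<open>Quotients by the trivial subspace\<close>

text \<open>Each topology lives on the union of its subbasis, so \<open>f\<close> maps one space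
  onto the other, and continuity both ways is tested on subbasic sets, which \<open>f\<close> puts
  in bijection.\<close>

lemma homeomorphic_map_topology_generated_by:
  assumes "inj f"
  shows "homeomorphic_map (topology_generated_by \<B>) (topology_generated_by ((`) f ` \<B>)) f"
proof -
  have inv_f: "inv_into UNIV f (f x) = x" for x
    using assms by simp
  have "continuous_map (topology_generated_by \<B>) (topology_generated_by ((`) f ` \<B>)) f"
  proof (rule continuous_on_generated_topo)
    fix U assume "U \<in> (`) f ` \<B>"
    then obtain B where B: "B \<in> \<B>" "U = f ` B" by blast
    then have "f -` U \<inter> topspace (topology_generated_by \<B>) = B"
      using assms by (auto dest: injD)
    then show "openin (topology_generated_by \<B>)
        (f -` U \<inter> topspace (topology_generated_by \<B>))"
      using B by (simp add: topology_generated_by_Basis)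
  qed (auto simp: image_Union)
  moreover have "continuous_map (topology_generated_by ((`) f ` \<B>)) (topology_generated_by \<B>) (inv_into UNIV f)"
  proof (rule continuous_on_generated_topo)
    fix B assume B: "B \<in> \<B>"
    \<comment> \<open>The intersection with the space matters: off the range of \<open>f\<close> the
      map \<open>inv_into UNIV f\<close> has arbitrary values.\<close>
    then have "inv_into UNIV f -` B \<inter> topspace (topology_generated_by ((`) f ` \<B>)) = f ` B"
      using inv_f by auto
    then show "openin (topology_generated_by ((`) f ` \<B>))
        (inv_into UNIV f -` B \<inter> topspace (topology_generated_by ((`) f ` \<B>)))"
      using B by (simp add: topology_generated_by_Basis)
  qed (use inv_f in auto)
  ultimately show ?thesis
    unfolding homeomorphic_map_maps homeomorphic_maps_def
    by (intro exI[of _ "inv_into UNIV f"]) (use inv_f in auto)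
qed

text \<open>Sums and differences of cosets of zero are computed from the additive group alone;
  scalars are treated separately in \<open>smult_quotient_zero\<close>.\<close>

locale additive_module = abelian_group V for V :: "('k, 'v) module" (structure)
begin

lemma carrier_quotient_zero: "carrier (quotient_module V {\<zero>}) = (\<lambda>x. {x}) ` carrier V"
  by (auto simp: quotient_module_def A_RCOSETS_def' a_r_coset_def')

lemma add_quotient_zero:
  "{x} \<oplus>\<^bsub>quotient_module V {\<zero>}\<^esub> {y} = {x \<oplus> y}"
  by (auto simp: quotient_module_def set_add_def')

text \<open>Balls of a seminorm are cut out by differences, hence the interest in this one. The
  quotient is not known to be a group at this point, so its negative, a definite description, is
  evaluated by exhibiting an inverse and proving it unique.\<close>

lemma minus_quotient_zero:
  assumes "x \<in> carrier V" "y \<in> carrier V"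
  shows "{y} \<ominus>\<^bsub>quotient_module V {\<zero>}\<^esub> {x} = {y \<ominus> x}"
proof -
  let ?Q = "quotient_module V {\<zero>}"
  have "\<ominus>\<^bsub>?Q\<^esub> {x} = {\<ominus> x}"
    unfolding a_inv_def[of ?Q] m_inv_def
  proof (rule the_equality)
    show "{\<ominus> x} \<in> carrier (add_monoid ?Q) \<and>
        {x} \<otimes>\<^bsub>add_monoid ?Q\<^esub> {\<ominus> x} = \<one>\<^bsub>add_monoid ?Q\<^esub> \<and>
        {\<ominus> x} \<otimes>\<^bsub>add_monoid ?Q\<^esub> {x} = \<one>\<^bsub>add_monoid ?Q\<^esub>"
      using assms
      by (auto simp: carrier_quotient_zero add_quotient_zero r_neg l_neg)
         (auto simp: quotient_module_def)
  next
    fix Y assume Y: "Y \<in> carrier (add_monoid ?Q) \<and>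
        {x} \<otimes>\<^bsub>add_monoid ?Q\<^esub> Y = \<one>\<^bsub>add_monoid ?Q\<^esub> \<and>
        Y \<otimes>\<^bsub>add_monoid ?Q\<^esub> {x} = \<one>\<^bsub>add_monoid ?Q\<^esub>"
    then obtain z where z: "z \<in> carrier V" "Y = {z}"
      by (auto simp: carrier_quotient_zero)
    with Y have "{z \<oplus> x} = \<zero>\<^bsub>?Q\<^esub>"
      by (simp add: add_quotient_zero)
    then have "z \<oplus> x = \<zero>"
      by (simp add: quotient_module_def)
    then show "Y = {\<ominus> x}"
      using z assms by (simp add: minus_equality)
  qed
  then show ?thesis
    by (simp add: a_minus_def add_quotient_zero)
qed

end

lemma smult_quotient_zero:
  assumes "abelian_group V" "c \<odot>\<^bsub>V\<^esub> x \<in> carrier V"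
  shows "c \<odot>\<^bsub>quotient_module V {\<zero>\<^bsub>V\<^esub>}\<^esub> {x} = {c \<odot>\<^bsub>V\<^esub> x}"
  using assms
  by (auto simp: quotient_module_def a_r_coset_def' abelian_group.axioms(1) abelian_monoid.l_zero)

text \<open>The singleton map matches the subbasic balls: the descended seminorm of
  \<open>{v}\<close> is the seminorm of \<open>v\<close>, and differences of singletons are
  singletons of differences.\<close>

lemma homeomorphic_map_quotient_zero:
  fixes V :: "('a, 'b) module"
  assumes V: "abelian_group V"
  shows "homeomorphic_map (seminorm_topology V P)
    (seminorm_topology (quotient_module V {\<zero>\<^bsub>V\<^esub>}) (descended_seminorm ` P)) (\<lambda>x. {x})"
proof -
  interpret additive_module V using V by (rule additive_module.intro)
  let ?Q = "quotient_module V {\<zero>\<^bsub>V\<^esub>}"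
  have ball: "{Y \<in> carrier ?Q. descended_seminorm p (Y \<ominus>\<^bsub>?Q\<^esub> {x}) < r} =
      (\<lambda>y. {y}) ` {y \<in> carrier V. p (y \<ominus>\<^bsub>V\<^esub> x) < r}" if "x \<in> carrier V" for p x r
    using that by (auto simp: carrier_quotient_zero minus_quotient_zero descended_seminorm_def)
  \<comment> \<open>Stated for arbitrary \<open>C\<close> and \<open>R\<close> to serve as a rewrite
    rule that pushes the image inside the comprehension.\<close>
  have image: "(`) g ` {C p x r | p x r. R p x r} = {g ` C p x r | p x r. R p x r}"
    for g :: "'b \<Rightarrow> 'b set" and C :: "('b \<Rightarrow> real) \<Rightarrow> 'b \<Rightarrow> real \<Rightarrow> 'b set" and R
    by blast
  have "{{Y \<in> carrier ?Q. q (Y \<ominus>\<^bsub>?Q\<^esub> X) < r} | q X r.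
        q \<in> descended_seminorm ` P \<and> X \<in> carrier ?Q \<and> 0 < r} =
      {{Y \<in> carrier ?Q. descended_seminorm p (Y \<ominus>\<^bsub>?Q\<^esub> {x}) < r} | p x r.
        p \<in> P \<and> x \<in> carrier V \<and> 0 < r}"
    unfolding carrier_quotient_zero by blast
  also have "\<dots> = (`) (\<lambda>y. {y}) ` {{y \<in> carrier V. p (y \<ominus>\<^bsub>V\<^esub> x) < r} | p x r.
        p \<in> P \<and> x \<in> carrier V \<and> 0 < r}"
    \<comment> \<open>The comprehensions are compared under their side conditions because
      \<open>ball\<close> is available only for centres in the carrier.\<close>
    unfolding image by (intro Collect_cong) (metis (no_types, lifting) ball)
  finally show ?thesis
    unfolding seminorm_topology_def
    by (simp add: homeomorphic_map_topology_generated_by)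
qed

text \<open>Completeness and separation of the target do not involve the source. What has to be
  transported along the singleton map is linearity, the embedding property and density of the
  image.\<close>

lemma is_completion_quotient_zero:
  assumes V: "abelian_group V"
    and smult: "\<And>c x. x \<in> carrier V \<Longrightarrow> c \<odot>\<^bsub>V\<^esub> x \<in> carrier V"
    and completion: "is_completion (quotient_module V {\<zero>\<^bsub>V\<^esub>})
      (seminorm_topology (quotient_module V {\<zero>\<^bsub>V\<^esub>}) (descended_seminorm ` P)) W S \<iota>"
  shows "is_completion V (seminorm_topology V P) W S (\<iota> \<circ> (\<lambda>x. {x}))"
proof -
  interpret additive_module V using V by (rule additive_module.intro)
  let ?Q = "quotient_module V {\<zero>\<^bsub>V\<^esub>}"
  note c = completion[unfolded is_completion_def]
  have "linear_between V W (\<iota> \<circ> (\<lambda>x. {x}))"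
    unfolding linear_between_def
  proof (intro conjI ballI allI)
    have l: "linear_between ?Q W \<iota>" using c by blast
    show "\<iota> \<circ> (\<lambda>x. {x}) \<in> carrier V \<rightarrow> carrier W"
      using l by (auto simp: linear_between_def carrier_quotient_zero)
    fix x assume x: "x \<in> carrier V"
    show "(\<iota> \<circ> (\<lambda>x. {x})) (x \<oplus>\<^bsub>V\<^esub> y) = (\<iota> \<circ> (\<lambda>x. {x})) x \<oplus>\<^bsub>W\<^esub> (\<iota> \<circ> (\<lambda>x. {x})) y"
      if "y \<in> carrier V" for y
      using l x that by (auto simp: linear_between_def carrier_quotient_zero add_quotient_zero)
    show "(\<iota> \<circ> (\<lambda>x. {x})) (k \<odot>\<^bsub>V\<^esub> x) = k \<odot>\<^bsub>W\<^esub> (\<iota> \<circ> (\<lambda>x. {x})) x" for k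
      \<comment> \<open>Read from right to left, \<open>smult_quotient_zero\<close> turns the
        singleton of a multiple into a multiple of a singleton, to which linearity of
        \<open>\<iota>\<close> applies.\<close>
      using l x
      by (simp add: linear_between_def carrier_quotient_zero
          flip: smult_quotient_zero[OF V smult[OF x]])
  qed
  moreover have "embedding_map (seminorm_topology V P) S (\<iota> \<circ> (\<lambda>x. {x}))"
    \<comment> \<open>A homeomorphism is a surjective embedding, and embeddings compose.\<close>
    using c homeomorphic_map_quotient_zero[OF V, of P]
    by (blast intro: embedding_map_compose dest: surjective_embedding_map[THEN iffD2])
  moreover have "(\<iota> \<circ> (\<lambda>x. {x})) ` carrier V = \<iota> ` carrier ?Q"
    by (simp add: carrier_quotient_zero image_comp)
  ultimately show ?thesis
    using c unfolding is_completion_def by simp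
qed


section \<open>Bounded right uniformly continuous functions\<close>

lemma right_uniformly_continuous_add:
  assumes "right_uniformly_continuous G T f" "right_uniformly_continuous G T g"
  shows "right_uniformly_continuous G T (\<lambda>x. f x + g x)"
  unfolding right_uniformly_continuous_def
proof (intro allI impI)
  fix \<epsilon> :: real assume "\<epsilon> > 0"
  then have "\<epsilon> / 2 > 0" by simp
  with assms obtain U V where
    U: "openin T U" "\<one>\<^bsub>G\<^esub> \<in> U" "\<forall>u\<in>U. \<forall>x\<in>carrier G. norm (f (u \<otimes>\<^bsub>G\<^esub> x) - f x) < \<epsilon> / 2" and
    V: "openin T V" "\<one>\<^bsub>G\<^esub> \<in> V" "\<forall>u\<in>V. \<forall>x\<in>carrier G. norm (g (u \<otimes>\<^bsub>G\<^esub> x) - g x) < \<epsilon> / 2"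
    unfolding right_uniformly_continuous_def by metis
  have "norm (f (u \<otimes>\<^bsub>G\<^esub> x) + g (u \<otimes>\<^bsub>G\<^esub> x) - (f x + g x)) < \<epsilon>"
    if "u \<in> U \<inter> V" "x \<in> carrier G" for u x
  proof -
    have "norm (f (u \<otimes>\<^bsub>G\<^esub> x) - f x) < \<epsilon> / 2" "norm (g (u \<otimes>\<^bsub>G\<^esub> x) - g x) < \<epsilon> / 2"
      using U V that by auto
    then have "norm (f (u \<otimes>\<^bsub>G\<^esub> x) - f x) + norm (g (u \<otimes>\<^bsub>G\<^esub> x) - g x) < \<epsilon>"
      by linarith
    then show ?thesis
      unfolding add_diff_add by (rule norm_triangle_lt)
  qed
  then show "\<exists>U. openin T U \<and> \<one>\<^bsub>G\<^esub> \<in> U \<and>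
      (\<forall>u\<in>U. \<forall>x\<in>carrier G. norm (f (u \<otimes>\<^bsub>G\<^esub> x) + g (u \<otimes>\<^bsub>G\<^esub> x) - (f x + g x)) < \<epsilon>)"
    using U V by (intro exI[of _ "U \<inter> V"]) auto
qed

text \<open>Comparison principle behind scalar multiples, the constant function on cosets and
  pointwise norms: increments dominated up to a factor inherit uniform continuity.\<close>

lemma right_uniformly_continuous_le:
  assumes f: "right_uniformly_continuous G T f"
    and le: "\<And>u x. u \<in> topspace T \<Longrightarrow> x \<in> carrier G \<Longrightarrow>
      norm (g (u \<otimes>\<^bsub>G\<^esub> x) - g x) \<le> C * norm (f (u \<otimes>\<^bsub>G\<^esub> x) - f x)"
  shows "right_uniformly_continuous G T g"
  unfolding right_uniformly_continuous_def
proof (intro allI impI)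
  fix \<epsilon> :: real assume "\<epsilon> > 0"
  \<comment> \<open>Adding 1 keeps the divisor positive, and \<open>\<bar>C\<bar> + 1\<close>
    dominates \<open>C\<close> whatever its sign.\<close>
  then have "\<epsilon> / (\<bar>C\<bar> + 1) > 0" by simp
  with f obtain U where U: "openin T U" "\<one>\<^bsub>G\<^esub> \<in> U"
      "\<forall>u\<in>U. \<forall>x\<in>carrier G. norm (f (u \<otimes>\<^bsub>G\<^esub> x) - f x) < \<epsilon> / (\<bar>C\<bar> + 1)"
    unfolding right_uniformly_continuous_def by metis
  have "norm (g (u \<otimes>\<^bsub>G\<^esub> x) - g x) < \<epsilon>" if "u \<in> U" "x \<in> carrier G" for u x
  proof -
    let ?d = "norm (f (u \<otimes>\<^bsub>G\<^esub> x) - f x)"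
    have "norm (g (u \<otimes>\<^bsub>G\<^esub> x) - g x) \<le> C * ?d"
      using le that U(1) openin_subset by blast
    also have "\<dots> \<le> (\<bar>C\<bar> + 1) * ?d"
      by (rule mult_right_mono) auto
    also have "\<dots> < \<epsilon>"
      using U(3) that by (simp add: pos_less_divide_eq mult.commute)
    finally show ?thesis .
  qed
  then show "\<exists>U. openin T U \<and> \<one>\<^bsub>G\<^esub> \<in> U \<and>
      (\<forall>u\<in>U. \<forall>x\<in>carrier G. norm (g (u \<otimes>\<^bsub>G\<^esub> x) - g x) < \<epsilon>)"
    using U by blast
qed

lemma right_uniformly_continuous_scaleC:
  "right_uniformly_continuous G T f \<Longrightarrow> right_uniformly_continuous G T (\<lambda>x. c *\<^sub>C f x)"
  by (erule right_uniformly_continuous_le[where C = "cmod c"])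
    (simp add: norm_scaleC flip: scaleC_diff_right)

lemma bounded_image_scaleC: "bounded (f ` A) \<Longrightarrow> bounded ((\<lambda>x. c *\<^sub>C f x) ` A)"
  by (force simp: bounded_iff norm_scaleC intro: mult_left_mono)

lemma (in topological_group) right_uniformly_continuous_const:
  "right_uniformly_continuous G T (\<lambda>x. c)"
  unfolding right_uniformly_continuous_def
  by (intro allI impI exI[of _ "carrier G"]) (use openin_topspace[of T] in \<open>simp add: topspace_eq\<close>)

section \<open>Functions on the coset space and point evaluations\<close>

lemma RUC_quotient_add:
  assumes "\<phi> \<in> RUC_quotient G T H" "\<psi> \<in> RUC_quotient G T H"
  shows "(\<lambda>X. \<phi> X + \<psi> X) \<in> RUC_quotient G T H"
  using assms
  by (simp add: RUC_quotient_def bounded_plus_comp right_uniformly_continuous_add)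

lemma RUC_quotient_cmult:
  assumes "\<phi> \<in> RUC_quotient G T H"
  shows "(\<lambda>X. c * \<phi> X) \<in> RUC_quotient G T H"
  \<comment> \<open>\<open>complex\<close> is a Hilbert space over itself, so the vector-valued
    facts specialise.\<close>
  using assms bounded_image_scaleC[of \<phi> _ c]
    right_uniformly_continuous_scaleC[of G T "\<lambda>x. \<phi> (x <#\<^bsub>G\<^esub> H)" c]
  by (simp add: RUC_quotient_def scaleC_complex_def)

lemma l_coset_in_lcosets: "x \<in> carrier G \<Longrightarrow> x <#\<^bsub>G\<^esub> H \<in> lcosets\<^bsub>G\<^esub> H"
  by (auto simp: LCOSETS_def)

lemma (in topological_group) indicator_in_RUC_quotient:
  "indicator (lcosets H) \<in> RUC_quotient G T H"
proof -
  have "right_uniformly_continuous G T (\<lambda>x. indicator (lcosets H) (x <#\<^bsub>G\<^esub> H) :: complex)"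
    \<comment> \<open>The lift is known to be 1 only at points of the group; increments there
      vanish, so comparison with the zero function works for any factor.\<close>
    by (rule right_uniformly_continuous_le[where C = 1,
          OF right_uniformly_continuous_const[of "0 :: complex"]])
      (simp add: topspace_eq l_coset_in_lcosets)
  then show ?thesis
    by (auto simp: RUC_quotient_def bounded_iff intro!: exI[of _ 1])
qed

text \<open>\<open>restrict\<close> supplies the extensionality demanded by \<open>means\<close>.
  Linearity and positivity are pointwise, and normalisation holds because the coset of
  \<open>x\<close> lies in the support of the indicator.\<close>

lemma (in topological_group) evaluation_in_means:
  assumes "x \<in> carrier G"
  shows "restrict (\<lambda>\<phi>. \<phi> (x <#\<^bsub>G\<^esub> H)) (RUC_quotient G T H) \<in> means G T H"
  using assms
  by (auto simp: means_def RUC_quotient_add RUC_quotient_cmult indicator_in_RUC_quotient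
      l_coset_in_lcosets)


section \<open>Sections\<close>

locale homogeneous_bundle = topological_group G T
  for G :: "('g, 'm) monoid_scheme" (structure) and T :: "'g topology" +
  fixes H :: "'g set" and \<tau> :: "'g \<Rightarrow> 'e::complex_hilbert_space \<Rightarrow> 'e"
  assumes subgroup: "subgroup H G"
    and unitary: "h \<in> H \<Longrightarrow> unitary_operator (\<tau> h)"
begin

text \<open>Inverses of unitaries are isometric, so the norm of a section is constant along a coset
  and \<open>the_elem\<close> acts on a genuine singleton.\<close>

lemma pointwise_norm_coset:
  assumes "f \<in> RUC_sections G T H \<tau>" "x \<in> carrier G"
  shows "pointwise_norm G H f (x <#\<^bsub>G\<^esub> H) = complex_of_real (norm (f x))"
proof -
  have "norm (f (x \<otimes> h)) = norm (f x)" if "h \<in> H" for h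
    using assms that by (simp add: RUC_sections_def norm_unitary[OF unitary_inv[OF unitary]])
  then have "norm (f y) = norm (f x)" if "y \<in> x <#\<^bsub>G\<^esub> H" for y
    using that unfolding l_coset_def by blast
  \<comment> \<open>Nonemptiness of the coset excludes an empty image.\<close>
  moreover have "x \<in> x <#\<^bsub>G\<^esub> H"
    unfolding l_coset_def
    by (rule UN_I[OF subgroup.one_closed[OF subgroup]]) (simp add: assms(2))
  ultimately have "(\<lambda>y. norm (f y)) ` (x <#\<^bsub>G\<^esub> H) = {norm (f x)}"
    by blast
  then show ?thesis
    by (simp add: pointwise_norm_def l_coset_in_lcosets assms(2))
qed

text \<open>The reverse triangle inequality bounds increments of the norm by those of
  \<open>f\<close>. Membership matters because means are prescribed only on this space.\<close>

lemma pointwise_norm_in_RUC_quotient: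
  assumes f: "f \<in> RUC_sections G T H \<tau>"
  shows "pointwise_norm G H f \<in> RUC_quotient G T H"
proof -
  have "bounded (pointwise_norm G H f ` (lcosets H))"
  proof -
    obtain B where "\<forall>x\<in>carrier G. norm (f x) \<le> B"
      using f by (auto simp: RUC_sections_def bounded_iff)
    then show ?thesis
      by (auto simp: bounded_iff LCOSETS_def pointwise_norm_coset[OF f] intro!: exI[of _ B])
  qed
  moreover have "right_uniformly_continuous G T (\<lambda>x. pointwise_norm G H f (x <#\<^bsub>G\<^esub> H))"
  proof (rule right_uniformly_continuous_le[where f = f and C = 1])
    show "right_uniformly_continuous G T f"
      using f by (simp add: RUC_sections_def)
    show "norm (pointwise_norm G H f ((u \<otimes> x) <#\<^bsub>G\<^esub> H) - pointwise_norm G H f (x <#\<^bsub>G\<^esub> H))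
        \<le> 1 * norm (f (u \<otimes> x) - f x)"
      if "u \<in> topspace T" "x \<in> carrier G" for u x
      using that
      by (simp add: pointwise_norm_coset[OF f] topspace_eq norm_triangle_ineq3 flip: of_real_diff)
  qed
  ultimately show ?thesis
    by (simp add: RUC_quotient_def pointwise_norm_def)
qed

lemma means_separate:
  assumes f: "f \<in> RUC_sections G T H \<tau>" and "f \<noteq> (\<lambda>x. 0)"
  shows "\<exists>\<mu>\<in>means G T H. mean_seminorm G H \<mu> f \<noteq> 0"
proof -
  obtain x where "f x \<noteq> 0"
    using assms(2) by (auto simp: fun_eq_iff)
  \<comment> \<open>Sections are extended by 0, so a nonzero value occurs inside the group.\<close>
  moreover from this have x: "x \<in> carrier G"
    using f by (auto simp: RUC_sections_def)
  ultimately have "mean_seminorm G H (restrict (\<lambda>\<phi>. \<phi> (x <#\<^bsub>G\<^esub> H)) (RUC_quotient G T H)) f \<noteq> 0"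
    by (simp add: mean_seminorm_def pointwise_norm_in_RUC_quotient[OF f] pointwise_norm_coset[OF f])
  then show ?thesis
    using evaluation_in_means[OF x] by blast
qed

lemma zero_in_RUC_sections: "(\<lambda>x. 0) \<in> RUC_sections G T H \<tau>"
  using right_uniformly_continuous_const[of "0 :: 'e"] unitary_zero[OF unitary_inv[OF unitary]]
  by (auto simp: RUC_sections_def bounded_iff)

lemma add_in_RUC_sections:
  assumes "f \<in> RUC_sections G T H \<tau>" "g \<in> RUC_sections G T H \<tau>"
  shows "(\<lambda>x. f x + g x) \<in> RUC_sections G T H \<tau>"
  using assms unitary_inv[OF unitary]
  by (simp add: RUC_sections_def bounded_plus_comp right_uniformly_continuous_add
      unitary_operator_def)

lemma scaleC_in_RUC_sections:
  assumes "f \<in> RUC_sections G T H \<tau>"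
  shows "(\<lambda>x. c *\<^sub>C f x) \<in> RUC_sections G T H \<tau>"
  using assms unitary_inv[OF unitary]
  by (simp add: RUC_sections_def bounded_image_scaleC right_uniformly_continuous_scaleC
      scaleC_zero_right unitary_operator_def)

section \<open>The vector space of sections, the null space and the completion\<close>

lemma abelian_group_RUC_section_space: "abelian_group (RUC_section_space G T H \<tau>)"
proof (rule abelian_groupI)
  fix f assume "f \<in> carrier (RUC_section_space G T H \<tau>)"
  \<comment> \<open>Closure under scalars provides negatives once negation is scaling by complex -1;
    the latter is then reduced to the real scalar -1.\<close>
  then have "(\<lambda>x. (- 1) *\<^sub>C f x) \<in> RUC_sections G T H \<tau>"
    by (simp add: RUC_section_space_def scaleC_in_RUC_sections)
  moreover have "(- 1) *\<^sub>C v + v = 0" for v :: 'e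
    using scaleR_scaleC[of "- 1" v, symmetric] by simp
  ultimately show "\<exists>g\<in>carrier (RUC_section_space G T H \<tau>).
      g \<oplus>\<^bsub>RUC_section_space G T H \<tau>\<^esub> f = \<zero>\<^bsub>RUC_section_space G T H \<tau>\<^esub>"
    by (intro bexI[where x = "\<lambda>x. (- 1) *\<^sub>C f x"]) (simp_all add: RUC_section_space_def)
qed (auto simp: RUC_section_space_def zero_in_RUC_sections add_in_RUC_sections algebra_simps)

text \<open>Separation by means gives one inclusion; homogeneity of each mean at the scalar 0 gives
  the other.\<close>

lemma J_means_eq: "J_means G T H \<tau> = {\<lambda>x. 0}"
proof -
  have "mean_seminorm G H \<mu> (\<lambda>x. 0 :: 'e) = 0" if \<mu>: "\<mu> \<in> means G T H" for \<mu>
  proof -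
    let ?n = "pointwise_norm G H (\<lambda>x. 0 :: 'e)"
    have "?n X = 0" for X
    proof (cases "X \<in> lcosets H")
      case True
      then show ?thesis
        using pointwise_norm_coset[OF zero_in_RUC_sections] by (auto simp: LCOSETS_def)
    qed (simp add: pointwise_norm_def)
    \<comment> \<open>The norm of the zero section is rewritten as 0 times itself so that
      homogeneity applies.\<close>
    then have "\<mu> ?n = \<mu> (\<lambda>X. 0 * ?n X)"
      by (intro arg_cong[of _ _ \<mu>] ext) simp
    also have "\<dots> = 0 * \<mu> ?n"
      using \<mu> pointwise_norm_in_RUC_quotient[OF zero_in_RUC_sections] unfolding means_def by blast
    finally show ?thesis
      by (simp add: mean_seminorm_def)
  qed
  then show ?thesis
    using means_separate zero_in_RUC_sections by (auto simp: J_means_def)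
qed

lemma reduction_map_eq: "reduction_map G T H \<tau> = (\<lambda>f. {f})"
  by (rule ext) (simp add: reduction_map_def J_means_eq a_r_coset_def' RUC_section_space_def)

text \<open>Once \<open>J_means\<close> is the zero subspace, \<open>is_Gamma_means\<close> asserts
  a completion of the quotient by zero, and the reduction map is the singleton map.\<close>

lemma is_completion_RUC_section_space:
  assumes "is_Gamma_means G T H \<tau> \<Gamma> S \<iota>"
  shows "is_completion (RUC_section_space G T H \<tau>) (RUC_section_topology G T H \<tau>) \<Gamma> S
    (\<iota> \<circ> reduction_map G T H \<tau>)"
  unfolding reduction_map_eq RUC_section_topology_def
proof (rule is_completion_quotient_zero[OF abelian_group_RUC_section_space])
  show "c \<odot>\<^bsub>RUC_section_space G T H \<tau>\<^esub> f \<in> carrier (RUC_section_space G T H \<tau>)"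
    if "f \<in> carrier (RUC_section_space G T H \<tau>)" for c f
    using that by (simp add: RUC_section_space_def scaleC_in_RUC_sections)
  have "{\<zero>\<^bsub>RUC_section_space G T H \<tau>\<^esub>} = J_means G T H \<tau>"
    by (simp add: J_means_eq RUC_section_space_def)
  then show "is_completion
      (quotient_module (RUC_section_space G T H \<tau>) {\<zero>\<^bsub>RUC_section_space G T H \<tau>\<^esub>})
      (seminorm_topology
        (quotient_module (RUC_section_space G T H \<tau>) {\<zero>\<^bsub>RUC_section_space G T H \<tau>\<^esub>})
        (descended_seminorm ` mean_seminorm G H ` means G T H)) \<Gamma> S \<iota>"
    \<comment> \<open>\<open>image_image\<close> fuses the nested images into the family of
      seminorms in \<open>reduced_section_topology\<close>.\<close>
    using assms
    by (simp add: is_Gamma_means_def reduced_section_space_def reduced_section_topology_def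
        image_image)
qed

end

theorem proposition1:
  fixes G :: "('g, 'm) monoid_scheme"
    and T :: "'g topology"
    and H :: "'g set"
    and \<tau> :: "'g \<Rightarrow> 'e::complex_hilbert_space \<Rightarrow> 'e"
  assumes "topological_group G T"
    and "subgroup H G"
    and "closedin T H"
    and "amenable (G\<lparr>carrier := H\<rparr>) (subtopology T H)"
    and "unitary_representation (G\<lparr>carrier := H\<rparr>) (subtopology T H) \<tau>"
  shows "(\<forall>f\<in>RUC_sections G T H \<tau>. f \<noteq> (\<lambda>x. 0) \<longrightarrow>
           (\<exists>\<mu>\<in>means G T H. mean_seminorm G H \<mu> f \<noteq> 0)) \<and>
         J_means G T H \<tau> = {\<lambda>x. 0} \<and>
         (\<forall>(\<Gamma> :: (complex, 'w) module) S \<iota>.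
           is_Gamma_means G T H \<tau> \<Gamma> S \<iota> \<longrightarrow>
           is_completion (RUC_section_space G T H \<tau>) (RUC_section_topology G T H \<tau>) \<Gamma> S
             (\<iota> \<circ> reduction_map G T H \<tau>))"
proof -
  \<comment> \<open>The carrier of the restricted group is \<open>H\<close>, so the representation
    gives unitarity of \<open>\<tau> h\<close> for \<open>h\<close> in \<open>H\<close>.\<close>
  interpret homogeneous_bundle G T H \<tau>
    using assms
    by (intro homogeneous_bundle.intro homogeneous_bundle_axioms.intro)
      (simp_all add: unitary_representation_def)
  show ?thesis
    using means_separate J_means_eq is_completion_RUC_section_space by blast
qed

end
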